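(* If $G$ is a finitely generated abelian group with no $2$-torsion, then $\operatorname{Aut}\big(\operatorname{Core}(G)\big)$ is a residually finite group.
   Context: A quandle is a non-empty set $X$ with a binary operation $*$ such that: (1) $x*x=x$ for all $x\in X$; (2) for all $x,y\in X$ there is a unique $z\in X$ with $x=z*y$; (3) $(x*y)*z=(x*z)*(y*z)$ for all $x,y,z\in X$. For a quandle $X$, $\operatorname{Aut}(X)$ is the group, under composition, of bijections $f:X\to X$ with $f(x*y)=f(x)*f(y)$ for all $x,y \in X$. For a group $G$, $\operatorname{Core}(G)$ is the set $G$ with the quandle operation $a*b=ba^{-1}b$ (in additive notation for abelian $G$: $a*b=2b-a$). A group $G$ is residually finite if for each $g\in G$, $g\ne1$, there are a finite group $F$ and a group homomorphism $\phi:G\to F$ with $\phi(g)\neq 1$. "No $2$-torsion" means that $G$ has no element of order $2$. *)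

theory Defs
  imports "HOL-Algebra.Algebra" "HOL-Algebra.Bij"
begin

section \<open>Quandles and their automorphism groups\<close>

record 'a quandle = "'a partial_object" +
  qop :: "'a \<Rightarrow> 'a \<Rightarrow> 'a"  (infixl \<open>\<star>\<index>\<close> 70)

locale quandle =
  fixes Q (structure)
  assumes nonempty: "carrier Q \<noteq> {}"
    and closed: "\<lbrakk>x \<in> carrier Q; y \<in> carrier Q\<rbrakk> \<Longrightarrow> x \<star> y \<in> carrier Q"
    and idem: "x \<in> carrier Q \<Longrightarrow> x \<star> x = x"
    and right_divisible:
      "\<lbrakk>x \<in> carrier Q; y \<in> carrier Q\<rbrakk> \<Longrightarrow> \<exists>!z. z \<in> carrier Q \<and> x = z \<star> y"
    and right_distrib:
      "\<lbrakk>x \<in> carrier Q; y \<in> carrier Q; z \<in> carrier Q\<rbrakk>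
        \<Longrightarrow> (x \<star> y) \<star> z = (x \<star> z) \<star> (y \<star> z)"

definition quandle_auto :: "('a, 'b) quandle_scheme \<Rightarrow> ('a \<Rightarrow> 'a) set"
  where "quandle_auto Q =
    {f \<in> Bij (carrier Q). \<forall>x\<in>carrier Q. \<forall>y\<in>carrier Q. f (x \<star>\<^bsub>Q\<^esub> y) = f x \<star>\<^bsub>Q\<^esub> f y}"

text \<open>As for \<^const>\<open>AutoGroup\<close>, maps are extensional on the carrier, so that
  each automorphism is represented by exactly one HOL function.\<close>

definition QuandleAutoGroup :: "('a, 'b) quandle_scheme \<Rightarrow> ('a \<Rightarrow> 'a) monoid"
  where "QuandleAutoGroup Q = BijGroup (carrier Q) \<lparr>carrier := quandle_auto Q\<rparr>"

definition Core :: "('a, 'b) monoid_scheme \<Rightarrow> 'a quandle"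
  where "Core G = \<lparr>carrier = carrier G, qop = \<lambda>a b. b \<otimes>\<^bsub>G\<^esub> inv\<^bsub>G\<^esub> a \<otimes>\<^bsub>G\<^esub> b\<rparr>"

lemma (in group) quandle_Core: "quandle (Core G)"
proof
  fix x y assume *: "x \<in> carrier (Core G)" "y \<in> carrier (Core G)"
  show "\<exists>!z. z \<in> carrier (Core G) \<and> x = z \<star>\<^bsub>Core G\<^esub> y"
  proof (rule ex1I[of _ "y \<otimes> inv x \<otimes> y"])
    show "y \<otimes> inv x \<otimes> y \<in> carrier (Core G) \<and> x = (y \<otimes> inv x \<otimes> y) \<star>\<^bsub>Core G\<^esub> y"
      using * by (simp add: Core_def inv_mult_group m_assoc flip: m_assoc[of y "inv y"])
  next
    fix z assume "z \<in> carrier (Core G) \<and> x = z \<star>\<^bsub>Core G\<^esub> y"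
    then show "z = y \<otimes> inv x \<otimes> y"
      using * by (simp add: Core_def inv_mult_group m_assoc flip: m_assoc[of y "inv y"])
  qed
next
  fix x y z assume "x \<in> carrier (Core G)" "y \<in> carrier (Core G)" "z \<in> carrier (Core G)"
  then show "(x \<star>\<^bsub>Core G\<^esub> y) \<star>\<^bsub>Core G\<^esub> z =
      (x \<star>\<^bsub>Core G\<^esub> z) \<star>\<^bsub>Core G\<^esub> (y \<star>\<^bsub>Core G\<^esub> z)"
    by (simp add: Core_def inv_mult_group m_assoc flip: m_assoc[of "inv z" z] m_assoc[of z "inv z"])
qed (auto simp: Core_def)

section \<open>Group-theoretic conditions\<close>

definition finitely_generated_group :: "('a, 'b) monoid_scheme \<Rightarrow> bool"
  where "finitely_generated_group G \<longleftrightarrow>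
    group G \<and> (\<exists>S. finite S \<and> S \<subseteq> carrier G \<and> generate G S = carrier G)"

definition no_2_torsion :: "('a, 'b) monoid_scheme \<Rightarrow> bool"
  where "no_2_torsion G \<longleftrightarrow> (\<forall>x\<in>carrier G. group.ord G x \<noteq> 2)"

text \<open>HOL cannot quantify over the type of the finite group \<open>F\<close>; since every finite group
  has an isomorphic copy with carrier in \<^typ>\<open>nat\<close>, nothing is lost by taking \<open>F\<close> on
  that type: see \<open>residually_finiteI\<close> below.\<close>

definition residually_finite :: "('a, 'b) monoid_scheme \<Rightarrow> bool"
  where "residually_finite G \<longleftrightarrow> group G \<and>
    (\<forall>g\<in>carrier G. g \<noteq> \<one>\<^bsub>G\<^esub> \<longrightarrow>
      (\<exists>(F :: nat monoid) \<phi>. group F \<and> finite (carrier F) \<and> \<phi> \<in> hom G F \<and> \<phi> g \<noteq> \<one>\<^bsub>F\<^esub>))"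

lemma finite_group_nat_copy:
  fixes F :: "('c, 'd) monoid_scheme"
  assumes "group F" "finite (carrier F)"
  obtains F' :: "nat monoid" and h
  where "group F'" "finite (carrier F')" "h \<in> iso F F'"
proof -
  interpret group F by fact
  obtain h :: "'c \<Rightarrow> nat" where inj: "inj_on h (carrier F)"
    using assms(2) finite_imp_inj_to_nat_seg by metis
  define k where "k = the_inv_into (carrier F) h"
  define F' where "F' = \<lparr>carrier = h ` carrier F,
    monoid.mult = \<lambda>a b. h (k a \<otimes>\<^bsub>F\<^esub> k b), one = h \<one>\<^bsub>F\<^esub>\<rparr>"
  have k [simp]: "k (h x) = x" if "x \<in> carrier F" for x
    using that inj by (simp add: k_def the_inv_into_f_f)
  have "group F'"
  proof (rule groupI)
    fix x assume "x \<in> carrier F'"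
    then obtain a where a: "a \<in> carrier F" "x = h a" by (auto simp: F'_def)
    then show "\<exists>y\<in>carrier F'. y \<otimes>\<^bsub>F'\<^esub> x = \<one>\<^bsub>F'\<^esub>"
      by (intro bexI[of _ "h (inv\<^bsub>F\<^esub> a)"]) (auto simp: F'_def)
  qed (auto simp: F'_def m_assoc)
  moreover have "finite (carrier F')"
    using assms(2) by (simp add: F'_def)
  moreover have "h \<in> iso F F'"
    using inj by (auto simp: iso_def hom_def bij_betw_def F'_def)
  ultimately show ?thesis by (rule that)
qed

lemma residually_finiteI:
  fixes G :: "('a, 'b) monoid_scheme"
  assumes "group G"
    and "\<And>g. \<lbrakk>g \<in> carrier G; g \<noteq> \<one>\<^bsub>G\<^esub>\<rbrakk> \<Longrightarrow>
      \<exists>(F :: ('c, 'd) monoid_scheme) \<phi>.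
        group F \<and> finite (carrier F) \<and> \<phi> \<in> hom G F \<and> \<phi> g \<noteq> \<one>\<^bsub>F\<^esub>"
  shows "residually_finite G"
  unfolding residually_finite_def
proof (intro conjI ballI impI)
  fix g assume g: "g \<in> carrier G" "g \<noteq> \<one>\<^bsub>G\<^esub>"
  then obtain F :: "('c, 'd) monoid_scheme" and \<phi>
    where F: "group F" "finite (carrier F)" "\<phi> \<in> hom G F" "\<phi> g \<noteq> \<one>\<^bsub>F\<^esub>"
    using assms(2) by blast
  obtain F' :: "nat monoid" and h
    where F': "group F'" "finite (carrier F')" "h \<in> iso F F'"
    using finite_group_nat_copy[OF F(1,2)] by blast
  have hom: "h \<in> hom F F'" and inj: "inj_on h (carrier F)"
    using F'(3) by (auto simp: iso_def bij_betw_def)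
  have "h (\<phi> g) \<noteq> h \<one>\<^bsub>F\<^esub>"
    using F inj g(1) by (metis group.is_monoid hom_in_carrier inj_onD monoid.one_closed)
  moreover have "h \<one>\<^bsub>F\<^esub> = \<one>\<^bsub>F'\<^esub>"
    using hom_one[OF hom F(1) F'(1)] .
  moreover have "h \<circ> \<phi> \<in> hom G F'"
    using F(3) hom by (rule hom_compose)
  ultimately show "\<exists>(F :: nat monoid) \<phi>.
      group F \<and> finite (carrier F) \<and> \<phi> \<in> hom G F \<and> \<phi> g \<noteq> \<one>\<^bsub>F\<^esub>"
    using F' by (intro exI[of _ F'] exI[of _ "h \<circ> \<phi>"]) simp
qed fact

end

(* Write abelian G additively. A quandle homomorphism f of Core(G) satisfies
   f(x + 2k y) = f(x) + 2k (f(y) - f(0)), so an automorphism permutes the cosets of each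
   subgroup 2kG, which has finite index when G is finitely generated. This gives homomorphisms
   from Aut(Core(G)) to finite permutation groups. If f(x) is different from x, the coset of x
   is moved as soon as f(x) - x is not in 2kG, and such a k exists: a maximal subgroup M
   avoiding f(x) - x has a quotient G/M of finite exponent. *)
theory Submission
  imports Defs
begin

section \<open>Finitely generated abelian groups\<close>

lemma set_multI: "\<lbrakk>h \<in> H; k \<in> K\<rbrakk> \<Longrightarrow> h \<otimes>\<^bsub>G\<^esub> k \<in> H <#>\<^bsub>G\<^esub> K"
  by (auto simp: set_mult_def)

text \<open>A product of two subgroups of an abelian group is again a subgroup, so it is enough that
  it contains the generators. This splits off one generator in inductions on a finite generating
  set.\<close>

lemma (in comm_group) generate_insert_subset:
  assumes "s \<in> carrier G" "S \<subseteq> carrier G"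
  shows "generate G (insert s S) \<subseteq> generate G {s} <#> generate G S"
proof (rule generate_subgroup_incl)
  show "subgroup (generate G {s} <#> generate G S) G"
    using assms by (intro mult_subgroups generate_is_subgroup) auto
  have "s \<otimes> \<one> \<in> generate G {s} <#> generate G S"
    by (intro set_multI generate.intros) simp
  moreover have "\<one> \<otimes> x \<in> generate G {s} <#> generate G S" if "x \<in> S" for x
    using that by (intro set_multI generate.intros)
  ultimately show "insert s S \<subseteq> generate G {s} <#> generate G S"
    using assms by (auto simp: subset_iff)
qed

lemma (in group) subgroup_nat_pow_mem:
  assumes "subgroup H G" "x \<in> H"
  shows "x [^] (k::nat) \<in> H"
  using subgroup_int_pow_closed[OF assms, of "int k"] by (simp add: int_pow_int)

text \<open>Taking \<open>n\<close>-th powers is an endomorphism of an abelian group. Through this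
  lemma an exponent that works for generators works for everything they generate.\<close>

lemma (in comm_group) subgroup_pow_vimage:
  assumes "subgroup H G"
  shows "subgroup {x \<in> carrier G. x [^] (n::nat) \<in> H} G"
proof (rule subgroupI)
  have "\<one> \<in> {x \<in> carrier G. x [^] n \<in> H}"
    using assms by (simp add: subgroup.one_closed)
  then show "{x \<in> carrier G. x [^] n \<in> H} \<noteq> {}" by blast
qed (use subgroup.m_closed[OF assms] subgroup.m_inv_closed[OF assms] in
    \<open>auto simp: nat_pow_distrib nat_pow_inv\<close>)

lemma (in comm_group) subgroup_pow_image:
  "subgroup ((\<lambda>x. x [^] (n::nat)) ` carrier G) G"
proof (rule subgroupI)
  fix a b
  assume "a \<in> (\<lambda>x. x [^] n) ` carrier G"
  then obtain x where x: "x \<in> carrier G" "a = x [^] n" by blast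
  then show "inv a \<in> (\<lambda>x. x [^] n) ` carrier G"
    by (auto intro!: image_eqI[of _ _ "inv x"] simp: nat_pow_inv)
  assume "b \<in> (\<lambda>x. x [^] n) ` carrier G"
  then obtain y where "y \<in> carrier G" "b = y [^] n" by blast
  with x show "a \<otimes> b \<in> (\<lambda>x. x [^] n) ` carrier G"
    by (auto intro!: image_eqI[of _ _ "x \<otimes> y"] simp: nat_pow_distrib)
qed auto

text \<open>The product of the exponents of the generators is a multiple of each of them, so it
  serves all generators at once, and \<open>subgroup_pow_vimage\<close> extends it to
  \<open>generate G S\<close>.\<close>

lemma (in comm_group) generate_common_exponent:
  assumes "finite S" "S \<subseteq> carrier G" "subgroup M G"
    and "\<And>s. s \<in> S \<Longrightarrow> \<exists>k>0. s [^] (k::nat) \<in> M"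
  shows "\<exists>n>0. \<forall>x\<in>generate G S. x [^] (n::nat) \<in> M"
proof -
  obtain k :: "'a \<Rightarrow> nat" where k: "k s > 0" "s [^] k s \<in> M" if "s \<in> S" for s
    using assms(4) by metis
  define n where "n = prod k S"
  have "s [^] n \<in> M" if "s \<in> S" for s
  proof -
    have "n = k s * prod k (S - {s})"
      using that assms(1) by (simp add: n_def prod.remove)
    then have "s [^] n = (s [^] k s) [^] prod k (S - {s})"
      using that assms(2) by (auto simp: nat_pow_pow)
    then show ?thesis
      using subgroup_nat_pow_mem[OF assms(3) k(2)[OF that]] by simp
  qed
  then have "generate G S \<subseteq> {x \<in> carrier G. x [^] n \<in> M}"
    using assms by (intro generate_subgroup_incl subgroup_pow_vimage) auto
  moreover have "n > 0"
    using k by (simp add: n_def prod_pos)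
  ultimately show ?thesis by blast
qed

section \<open>Separating an element from a subgroup of powers\<close>

lemma (in group) ex_maximal_subgroup_avoiding:
  assumes "g \<noteq> \<one>"
  obtains M where "subgroup M G" "g \<notin> M"
    "\<And>H. \<lbrakk>subgroup H G; M \<subseteq> H; g \<notin> H\<rbrakk> \<Longrightarrow> H = M"
proof -
  let ?A = "{H. subgroup H G \<and> g \<notin> H}"
  have "\<exists>M\<in>?A. \<forall>H\<in>?A. M \<subseteq> H \<longrightarrow> H = M"
  proof (rule subset_Zorn_nonempty)
    show "?A \<noteq> {}"
      using triv_subgroup assms by blast
    \<comment> \<open>Zorn's lemma applies because the union of a nonempty chain is a subgroup: two
      of its elements already lie in a common member of the chain.\<close>
    fix C assume C: "C \<noteq> {}" "subset.chain ?A C"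
    then have sub: "subgroup H G" "g \<notin> H" if "H \<in> C" for H
      using that by (auto simp: subset.chain_def)
    have "subgroup (\<Union>C) G"
    proof (rule subgroupI)
      show "\<Union>C \<subseteq> carrier G"
        using sub subgroup.subset by blast
      show "\<Union>C \<noteq> {}"
        using C(1) sub subgroup.one_closed by blast
      show "inv a \<in> \<Union>C" if a: "a \<in> \<Union>C" for a
      proof -
        obtain H where H: "H \<in> C" "a \<in> H"
          using a by blast
        then show ?thesis
          using subgroup.m_inv_closed[OF sub(1)] by blast
      qed
      show "a \<otimes> b \<in> \<Union>C" if ab: "a \<in> \<Union>C" "b \<in> \<Union>C" for a b
      proof -
        obtain H K where HK: "H \<in> C" "a \<in> H" "K \<in> C" "b \<in> K"
          using ab by blast
        then have "H \<subseteq> K \<or> K \<subseteq> H"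
          using C(2) by (simp add: subset_chain_def)
        then have "a \<otimes> b \<in> H \<or> a \<otimes> b \<in> K"
          using subgroup.m_closed[OF sub(1)[OF HK(1)], of a b]
            subgroup.m_closed[OF sub(1)[OF HK(3)], of a b] HK by blast
        then show ?thesis
          using HK by blast
      qed
    qed
    then show "\<Union>C \<in> ?A"
      using sub by blast
  qed
  then show ?thesis using that by blast
qed

text \<open>Modulo a maximal subgroup \<open>M\<close> avoiding \<open>g\<close>, every nontrivial subgroup contains \<open>g\<close>.
  If \<open>x\<close> had infinite order modulo \<open>M\<close>, then \<open>g\<close> would be a nonzero power \<open>x\<^sup>i\<close> and also a power
  of \<open>x\<^sup>2\<^sup>i\<close>, which is absurd.\<close>

lemma (in comm_group) torsion_mod_maximal_avoiding:
  assumes M: "subgroup M G" "g \<notin> M"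
    and max: "\<And>H. \<lbrakk>subgroup H G; M \<subseteq> H; g \<notin> H\<rbrakk> \<Longrightarrow> H = M"
    and x: "x \<in> carrier G"
  shows "\<exists>k>0. x [^] (k::nat) \<in> M"
proof (rule ccontr)
  assume "\<not> ?thesis"
  then have nat: "x [^] k \<notin> M" if "k > 0" for k :: nat
    using that by blast
  have nonzero: "x [^] k \<notin> M" if "k \<noteq> 0" for k :: int
  proof (cases k rule: int_cases2)
    case (nonneg n)
    then show ?thesis using nat[of n] that by (simp add: int_pow_int)
  next
    case (nonpos n)
    then have "inv (x [^] k) = x [^] n"
      using x by (simp add: int_pow_neg int_pow_int)
    then show ?thesis
      using nat[of n] that nonpos M(1) subgroup.m_inv_closed by fastforce
  qed
  \<comment> \<open>Adjoining \<open>x [^] k\<close> to \<open>M\<close> enlarges it strictly, so by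
    maximality the larger subgroup contains \<open>g\<close>.\<close>
  have mem: "\<exists>m\<in>M. \<exists>i. g = m \<otimes> x [^] (k * i)" if "k \<noteq> 0" for k :: int
  proof -
    let ?H = "M <#> generate G {x [^] k}"
    have "subgroup ?H G"
      using M(1) x by (intro mult_subgroups generate_is_subgroup) auto
    moreover have "M \<subseteq> ?H"
    proof
      fix m assume m: "m \<in> M"
      then have "m \<otimes> \<one> \<in> ?H"
        by (intro set_multI generate.one)
      then show "m \<in> ?H"
        using m M(1) subgroup.mem_carrier by fastforce
    qed
    moreover have "\<one> \<otimes> x [^] k \<in> ?H"
      using subgroup.one_closed[OF M(1)] by (intro set_multI generate.incl) simp_all
    then have "?H \<noteq> M"
      using nonzero[OF that] x by auto
    ultimately have "g \<in> ?H"
      using max by blast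
    then show ?thesis
      using x by (auto simp: set_mult_def generate_pow int_pow_pow)
  qed
  obtain m and i :: int where m: "m \<in> M" "g = m \<otimes> x [^] i"
    using mem[of 1] by auto
  \<comment> \<open>With \<open>i = 0\<close> the element \<open>g\<close> would equal
    \<open>m\<close> and lie in \<open>M\<close>.\<close>
  have "i \<noteq> 0"
    using m M subgroup.mem_carrier by fastforce
  then obtain m' and j :: int where m': "m' \<in> M" "g = m' \<otimes> x [^] (2 * i * j)"
    using mem[of "2 * i"] by auto
  have car: "m \<in> carrier G" "m' \<in> carrier G"
    using subgroup.mem_carrier[OF M(1)] m(1) m'(1) by simp_all
  \<comment> \<open>Comparing the two expressions for \<open>g\<close> puts this power of
    \<open>x\<close> in \<open>M\<close>, so its exponent \<open>i * (1 - 2 * j)\<close> vanishes,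
    although \<open>i\<close> is nonzero and \<open>1 - 2 * j\<close> is odd.\<close>
  have "x [^] (i - 2 * i * j) = inv m \<otimes> g \<otimes> inv (x [^] (2 * i * j))"
    unfolding m(2) using x car by (simp add: int_pow_diff flip: m_assoc)
  also have "\<dots> = inv m \<otimes> m'"
    unfolding m'(2) using x car by (simp add: m_assoc)
  also have "\<dots> \<in> M"
    using subgroup.m_closed[OF M(1)] subgroup.m_inv_closed[OF M(1)] m(1) m'(1) by simp
  finally have "i - 2 * i * j = 0"
    using nonzero by blast
  then have "i * (1 - 2 * j) = 0"
    by (simp add: algebra_simps)
  moreover have "1 - 2 * j \<noteq> 0"
    by presburger
  ultimately show False
    using \<open>i \<noteq> 0\<close> by simp
qed

text \<open>For \<open>M\<close> maximal avoiding \<open>g\<close>, the quotient by \<open>M\<close>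
  is torsion and finitely generated, hence of finite exponent \<open>n\<close>. All
  \<open>n\<close>-th powers then lie in \<open>M\<close>, which misses \<open>g\<close>.\<close>

lemma (in comm_group) ex_not_pow:
  assumes "finite S" "S \<subseteq> carrier G" "generate G S = carrier G" and "g \<noteq> \<one>"
  shows "\<exists>n>0. g \<notin> (\<lambda>x. x [^] (n::nat)) ` carrier G"
proof -
  obtain M where M: "subgroup M G" "g \<notin> M"
    "\<And>H. \<lbrakk>subgroup H G; M \<subseteq> H; g \<notin> H\<rbrakk> \<Longrightarrow> H = M"
    using ex_maximal_subgroup_avoiding[OF assms(4)] by metis
  have "\<exists>n>0. \<forall>x\<in>generate G S. x [^] (n::nat) \<in> M"
    using assms(2) torsion_mod_maximal_avoiding[OF M]
    by (intro generate_common_exponent[OF assms(1,2) M(1)]) blast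
  then show ?thesis
    unfolding assms(3) using M(2) by blast
qed

section \<open>Finite index of the subgroup of powers\<close>

lemma (in comm_group) finite_representatives_mod_powers:
  assumes "finite S" "S \<subseteq> carrier G" and n: "n > 0"
  shows "\<exists>A. finite A \<and> A \<subseteq> carrier G \<and>
    generate G S \<subseteq> (\<lambda>x. x [^] (n::nat)) ` carrier G <#> A"
  using assms(1,2)
proof (induction S)
  case empty
  have "\<one> [^] n \<otimes> \<one> \<in> (\<lambda>x. x [^] n) ` carrier G <#> {\<one>}"
    by (intro set_multI imageI) simp_all
  then show ?case
    by (intro exI[of _ "{\<one>}"]) (simp add: generate_empty)
next
  case (insert s S)
  let ?N = "(\<lambda>x. x [^] n) ` carrier G"
  obtain A where A: "finite A" "A \<subseteq> carrier G" "generate G S \<subseteq> ?N <#> A"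
    using insert by auto
  have s: "s \<in> carrier G" using insert by simp
  \<comment> \<open>Modulo \<open>n\<close>-th powers the exponent of \<open>s\<close> matters only
    through its remainder, so \<open>n\<close> multiples of each old representative suffice.\<close>
  define B where "B = (\<lambda>(i, a). s [^] (i::int) \<otimes> a) ` ({0..<int n} \<times> A)"
  have "generate G (insert s S) \<subseteq> generate G {s} <#> generate G S"
    using s insert.prems by (intro generate_insert_subset) auto
  also have "\<dots> \<subseteq> ?N <#> B"
  proof
    fix x assume "x \<in> generate G {s} <#> generate G S"
    then obtain k :: int and y where y: "y \<in> generate G S" "x = s [^] k \<otimes> y"
      using s by (auto simp: set_mult_def generate_pow)
    then have "y \<in> ?N <#> A"
      using A(3) by blast
    then obtain z a where z: "z \<in> carrier G" "a \<in> A" "y = z [^] n \<otimes> a"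
      by (auto simp: set_mult_def)
    have a: "a \<in> carrier G" using A(2) z(2) by blast
    \<comment> \<open>Dividing \<open>k\<close> by \<open>n\<close>, the quotient part of
      \<open>s [^] k\<close> is an \<open>n\<close>-th power and joins \<open>z\<close> in
      \<open>w\<close>; the remainder part goes into the representative.\<close>
    define w where "w = s [^] (k div int n) \<otimes> z"
    have "s [^] k = (s [^] (k div int n)) [^] n \<otimes> s [^] (k mod int n)"
      using s by (simp add: int_pow_pow flip: int_pow_int int_pow_mult)
    then have "x = w [^] n \<otimes> (s [^] (k mod int n) \<otimes> a)"
      using s z(1) a by (simp add: y(2) z(3) w_def nat_pow_distrib m_ac)
    moreover have "s [^] (k mod int n) \<otimes> a \<in> B"
      unfolding B_def using n z(2) by (intro image_eqI[of _ _ "(k mod int n, a)"]) auto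
    moreover have "w \<in> carrier G"
      using s z(1) by (simp add: w_def)
    ultimately show "x \<in> ?N <#> B"
      by (simp add: set_multI)
  qed
  finally have "generate G (insert s S) \<subseteq> ?N <#> B" .
  moreover have "finite B" "B \<subseteq> carrier G"
    using A(1,2) s by (auto simp: B_def)
  ultimately show ?case
    by (intro exI[of _ B] conjI)
qed

lemma (in comm_group) finite_rcosets_powers:
  assumes "finite S" "S \<subseteq> carrier G" "generate G S = carrier G" and "n > 0"
  shows "finite (rcosets ((\<lambda>x. x [^] (n::nat)) ` carrier G))"
proof -
  let ?N = "(\<lambda>x. x [^] n) ` carrier G"
  obtain A where A: "finite A" "A \<subseteq> carrier G" "carrier G \<subseteq> ?N <#> A"
    using finite_representatives_mod_powers[OF assms(1,2,4)] assms(3) by auto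
  have "rcosets ?N \<subseteq> (\<lambda>a. ?N #> a) ` A"
  proof
    fix C assume "C \<in> rcosets ?N"
    then obtain x where x: "x \<in> carrier G" "C = ?N #> x"
      by (auto simp: RCOSETS_def)
    then obtain a where a: "a \<in> A" "x \<in> ?N #> a"
      using A(3) unfolding set_mult_def r_coset_def by blast
    then have "?N #> a = ?N #> x"
      using repr_independence[OF _ _ subgroup_pow_image] A(2) by blast
    then show "C \<in> (\<lambda>a. ?N #> a) ` A"
      using a(1) x(2) by blast
  qed
  then show ?thesis
    using A(1) finite_subset by blast
qed

section \<open>Automorphisms of quandles\<close>

lemma (in quandle) subgroup_quandle_auto:
  "subgroup (quandle_auto Q) (BijGroup (carrier Q))"
proof (rule subgroup.intro)
  show "quandle_auto Q \<subseteq> carrier (BijGroup (carrier Q))"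
    by (auto simp: quandle_auto_def BijGroup_def)
next
  fix f g
  assume "f \<in> quandle_auto Q" "g \<in> quandle_auto Q"
  then show "f \<otimes>\<^bsub>BijGroup (carrier Q)\<^esub> g \<in> quandle_auto Q"
    using Bij_imp_funcset[of g]
    by (auto simp: quandle_auto_def BijGroup_def compose_Bij compose_eq closed Pi_iff)
next
  show "\<one>\<^bsub>BijGroup (carrier Q)\<^esub> \<in> quandle_auto Q"
    by (simp add: quandle_auto_def BijGroup_def id_Bij closed)
next
  fix f
  assume f: "f \<in> quandle_auto Q"
  then show "inv\<^bsub>BijGroup (carrier Q)\<^esub> f \<in> quandle_auto Q"
    using Bij_inv_into_lemma[where g = "qop Q" and S = "carrier Q" and h = f]
    by (simp add: quandle_auto_def inv_BijGroup restrict_inv_into_Bij closed)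
qed

lemma (in quandle) group_QuandleAutoGroup: "group (QuandleAutoGroup Q)"
  unfolding QuandleAutoGroup_def
  using subgroup.subgroup_is_group[OF subgroup_quandle_auto group_BijGroup] .

lemma finite_carrier_BijGroup:
  assumes "finite S"
  shows "finite (carrier (BijGroup S))"
proof (rule finite_subset)
  \<comment> \<open>Members of \<open>Bij S\<close> are extensional, so they form a subset of a
    finite function space.\<close>
  show "carrier (BijGroup S) \<subseteq> S \<rightarrow>\<^sub>E S"
    using Bij_imp_funcset by (auto simp: BijGroup_def PiE_def Bij_imp_extensional)
qed (use assms in \<open>simp add: finite_PiE\<close>)

lemma image_mem_Bij:
  assumes "inj_on f (\<Union>P)" "(`) f ` P = P"
  shows "(\<lambda>C\<in>P. f ` C) \<in> Bij P"
  using assms by (simp add: Bij_def bij_betw_def inj_on_image)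

section \<open>Automorphisms of core quandles\<close>

lemma (in comm_group) core_auto_pow:
  assumes f: "f \<in> carrier G \<rightarrow> carrier G"
    "\<And>a b. \<lbrakk>a \<in> carrier G; b \<in> carrier G\<rbrakk> \<Longrightarrow> f (b \<otimes> inv a \<otimes> b) = f b \<otimes> inv (f a) \<otimes> f b"
    and xy: "x \<in> carrier G" "y \<in> carrier G"
  shows "f (y [^] (2 * n :: nat) \<otimes> x) = (f y \<otimes> inv (f \<one>)) [^] (2 * n) \<otimes> f x"
proof -
  have fc: "f a \<in> carrier G" if "a \<in> carrier G" for a
    using that f(1) by blast
  \<comment> \<open>Multiplication by the square of \<open>y\<close> is the reflection in
    \<open>\<one>\<close> followed by the reflection in \<open>y\<close>. The map \<open>f\<close>
    carries these to the reflections in \<open>f \<one>\<close> and \<open>f y\<close>, whose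
    composite is multiplication by the square of
    \<open>f y \<otimes> inv (f \<one>)\<close>.\<close>
  have "f (y \<otimes> y \<otimes> a) = (f y \<otimes> inv (f \<one>)) \<otimes> (f y \<otimes> inv (f \<one>)) \<otimes> f a" 
    if a: "a \<in> carrier G" for a
  proof -
    have "f (inv a) = f \<one> \<otimes> inv (f a) \<otimes> f \<one>"
      using f(2)[of a \<one>] a by simp
    moreover have "f (y \<otimes> y \<otimes> a) = f y \<otimes> inv (f (inv a)) \<otimes> f y"
      using f(2)[of "inv a" y] a xy by (simp add: m_ac)
    ultimately show ?thesis
      using a xy fc by (simp add: inv_mult_group m_ac)
  qed
  note step = this
  show ?thesis
  proof (induction n)
    case 0
    then show ?case using xy fc by simp
  next
    case (Suc n)
    let ?u = "f y \<otimes> inv (f \<one>)"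
    have u: "?u \<in> carrier G"
      using fc xy by simp
    have "f (y [^] (2 * Suc n) \<otimes> x) = f (y \<otimes> y \<otimes> (y [^] (2 * n) \<otimes> x))"
      using xy by (simp add: m_ac)
    also have "\<dots> = ?u \<otimes> ?u \<otimes> (?u [^] (2 * n) \<otimes> f x)"
      using xy by (simp add: step Suc)
    also have "\<dots> = ?u \<otimes> ?u \<otimes> ?u [^] (2 * n) \<otimes> f x"
      using u fc xy by (simp only: m_assoc m_closed nat_pow_closed)
    also have "?u \<otimes> ?u \<otimes> ?u [^] (2 * n) = ?u [^] (2 * Suc n)"
      using u by (simp only: nat_pow_Suc2 mult_Suc_right numeral_2_eq_2 add_Suc add_0 m_assoc m_closed nat_pow_closed)
    finally show ?case .
  qed
qed

lemma (in comm_group) core_auto_image_rcoset: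
  fixes n :: nat
  assumes f: "f \<in> quandle_auto (Core G)" and x: "x \<in> carrier G"
  defines "N \<equiv> (\<lambda>x. x [^] (2 * n)) ` carrier G"
  shows "f ` (N #> x) = N #> f x"
proof -
  interpret quandle "Core G" by (rule quandle_Core)
  \<comment> \<open>This inclusion is proved for an arbitrary automorphism \<open>h\<close> because
    it is needed both for \<open>f\<close> and for its inverse.\<close>
  have sub: "h ` (N #> x) \<subseteq> N #> h x" if h: "h \<in> quandle_auto (Core G)" and x: "x \<in> carrier G" for h x
  proof -
    have hc: "h \<in> carrier G \<rightarrow> carrier G"
      using h Bij_imp_funcset by (auto simp: quandle_auto_def Core_def)
    have "h (y [^] (2 * n) \<otimes> x) \<in> N #> h x" if y: "y \<in> carrier G" for y
    proof -
      have "h (y [^] (2 * n) \<otimes> x) = (h y \<otimes> inv (h \<one>)) [^] (2 * n) \<otimes> h x"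
        using h by (intro core_auto_pow hc x y) (auto simp: quandle_auto_def Core_def)
      moreover have "h y \<otimes> inv (h \<one>) \<in> carrier G"
        using hc y by (auto simp: Pi_iff)
      ultimately show ?thesis
        unfolding N_def r_coset_def by blast
    qed
    then show ?thesis
      by (auto simp: N_def r_coset_def)
  qed
  \<comment> \<open>This is the inverse of \<open>f\<close> in \<open>BijGroup\<close>. The
    inclusion for \<open>?g\<close> at \<open>f x\<close>, pushed forward by \<open>f\<close>, is
    the reverse inclusion for \<open>f\<close>.\<close>
  let ?g = "\<lambda>y\<in>carrier G. inv_into (carrier G) f y"
  have bij: "bij_betw f (carrier G) (carrier G)" "f \<in> Bij (carrier G)"
    using f by (auto simp: quandle_auto_def Core_def Bij_def)
  have g: "?g \<in> quandle_auto (Core G)"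
    using subgroup.m_inv_closed[OF subgroup_quandle_auto f] bij
    by (simp add: Core_def inv_BijGroup)
  have fx: "f x \<in> carrier G"
    using bij x bij_betwE by blast
  have "?g ` (N #> f x) \<subseteq> N #> x"
    using sub[OF g fx] bij x by (simp add: fx bij_betw_inv_into_left)
  then have "f ` ?g ` (N #> f x) \<subseteq> f ` (N #> x)"
    by blast
  moreover have "f ` ?g ` (N #> f x) = N #> f x"
  proof -
    have "N #> f x \<subseteq> carrier G"
      using fx by (auto simp: N_def r_coset_def)
    then have "f (?g y) = y" if "y \<in> N #> f x" for y
      using that bij_betw_inv_into_right[OF bij(1), of y] by (simp add: subset_iff)
    then show ?thesis
      unfolding image_image by (simp del: restrict_apply cong: image_cong)
  qed
  ultimately have "N #> f x \<subseteq> f ` (N #> x)"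
    by simp
  with sub[OF f x] show ?thesis
    by (rule subset_antisym)
qed

section \<open>The action on cosets\<close>

lemma (in comm_group) core_auto_image_rcosets:
  fixes n :: nat
  assumes f: "f \<in> quandle_auto (Core G)"
  defines "P \<equiv> rcosets ((\<lambda>x. x [^] (2 * n)) ` carrier G)"
  shows "(\<lambda>C\<in>P. f ` C) \<in> Bij P"
proof (rule image_mem_Bij)
  let ?N = "(\<lambda>x. x [^] (2 * n)) ` carrier G"
  have bij: "bij_betw f (carrier G) (carrier G)"
    using f by (auto simp: quandle_auto_def Core_def Bij_def)
  have "\<Union>P \<subseteq> carrier G"
    by (auto simp: P_def RCOSETS_def r_coset_def)
  then show "inj_on f (\<Union>P)"
    using bij bij_betw_imp_inj_on inj_on_subset by blast
  have P: "P = (\<lambda>x. ?N #> x) ` carrier G"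
    by (auto simp: P_def RCOSETS_def)
  \<comment> \<open>The coset of \<open>x\<close> goes to the coset of \<open>f x\<close>, and
    \<open>f x\<close> runs through the whole group as \<open>x\<close> does.\<close>
  have "(`) f ` P = (\<lambda>x. ?N #> f x) ` carrier G"
    unfolding P image_image by (intro image_cong refl core_auto_image_rcoset[OF f])
  also have "\<dots> = (\<lambda>y. ?N #> y) ` f ` carrier G"
    by (simp add: image_image)
  also have "\<dots> = P"
    using bij by (simp add: P bij_betw_imp_surj_on)
  finally show "(`) f ` P = P" .
qed

lemma (in comm_group) coset_action_hom:
  fixes n :: nat
  defines "P \<equiv> rcosets ((\<lambda>x. x [^] (2 * n)) ` carrier G)"
  shows "(\<lambda>f. \<lambda>C\<in>P. f ` C) \<in> hom (QuandleAutoGroup (Core G)) (BijGroup P)"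
proof (rule homI)
  fix f
  assume "f \<in> carrier (QuandleAutoGroup (Core G))"
  then show "(\<lambda>C\<in>P. f ` C) \<in> carrier (BijGroup P)"
    using core_auto_image_rcosets by (simp add: QuandleAutoGroup_def BijGroup_def P_def)
next
  fix f g
  assume "f \<in> carrier (QuandleAutoGroup (Core G))" "g \<in> carrier (QuandleAutoGroup (Core G))"
  then have fg: "f \<in> quandle_auto (Core G)" "g \<in> quandle_auto (Core G)"
    by (simp_all add: QuandleAutoGroup_def)
  then have Bij: "(\<lambda>C\<in>P. f ` C) \<in> Bij P" "(\<lambda>C\<in>P. g ` C) \<in> Bij P"
    using core_auto_image_rcosets by (simp_all add: P_def)
  have sub: "C \<subseteq> carrier G" if "C \<in> P" for C
    using that by (auto simp: P_def RCOSETS_def r_coset_def)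
  have "f \<otimes>\<^bsub>QuandleAutoGroup (Core G)\<^esub> g = compose (carrier G) f g"
    using fg by (simp add: QuandleAutoGroup_def BijGroup_def quandle_auto_def Core_def)
  \<comment> \<open>\<open>compose (carrier G) f g\<close> agrees with ordinary composition only on
    the carrier, hence the use of \<open>sub\<close>.\<close>
  moreover have "compose (carrier G) f g ` C = f ` g ` C" if "C \<in> P" for C
    using sub[OF that] by (force simp: compose_def)
  moreover have "g ` C \<in> P" if "C \<in> P" for C
    using Bij_imp_funcset[OF Bij(2)] that by (auto simp: Pi_iff)
  ultimately show "(\<lambda>C\<in>P. (f \<otimes>\<^bsub>QuandleAutoGroup (Core G)\<^esub> g) ` C) =
      (\<lambda>C\<in>P. f ` C) \<otimes>\<^bsub>BijGroup P\<^esub> (\<lambda>C\<in>P. g ` C)"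
    using Bij by (simp add: BijGroup_def compose_def cong: restrict_cong)
qed

section \<open>Detecting a nontrivial automorphism in a finite permutation group\<close>

lemma (in comm_group) residually_finite_QuandleAutoGroup_Core:
  assumes "finitely_generated_group G"
  shows "residually_finite (QuandleAutoGroup (Core G))"
proof (rule residually_finiteI)
  interpret quandle "Core G" by (rule quandle_Core)
  show "group (QuandleAutoGroup (Core G))"
    by (rule group_QuandleAutoGroup)
  obtain S where S: "finite S" "S \<subseteq> carrier G" "generate G S = carrier G"
    using assms unfolding finitely_generated_group_def by blast
  fix f
  assume "f \<in> carrier (QuandleAutoGroup (Core G))" "f \<noteq> \<one>\<^bsub>QuandleAutoGroup (Core G)\<^esub>"
  then have f: "f \<in> quandle_auto (Core G)" "f \<noteq> (\<lambda>x\<in>carrier G. x)"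
    by (simp_all add: QuandleAutoGroup_def BijGroup_def Core_def)
  then have fB: "f \<in> Bij (carrier G)"
    by (simp add: quandle_auto_def Core_def)
  \<comment> \<open>Both \<open>f\<close> and the identity are extensional, so they can differ only
    at a point of the carrier.\<close>
  have "\<exists>x\<in>carrier G. f x \<noteq> x"
  proof (rule ccontr)
    assume "\<not> ?thesis"
    then have "f = (\<lambda>x\<in>carrier G. x)"
      by (intro extensionalityI[OF Bij_imp_extensional[OF fB] restrict_extensional]) simp
    with f(2) show False ..
  qed
  then obtain x where x: "x \<in> carrier G" "f x \<noteq> x"
    by blast
  have fx: "f x \<in> carrier G"
    using fB x(1) Bij_imp_funcset by blast
  have "f x \<otimes> inv x \<noteq> \<one>"
    using x fx inv_equality[of "f x" "inv x"] by auto
  then obtain n :: nat where n: "n > 0" "f x \<otimes> inv x \<notin> (\<lambda>x. x [^] n) ` carrier G"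
    using ex_not_pow[OF S] by blast
  \<comment> \<open>The exponent is doubled because \<open>core_auto_image_rcoset\<close> concerns
    even powers. The excluded element stays excluded, since \<open>2 * n\<close>-th powers are
    \<open>n\<close>-th powers.\<close>
  define N where "N = (\<lambda>x. x [^] (2 * n)) ` carrier G"
  have "N \<subseteq> (\<lambda>x. x [^] n) ` carrier G"
  proof
    fix y assume "y \<in> N"
    then obtain z where z: "z \<in> carrier G" "y = z [^] (2 * n)"
      by (auto simp: N_def)
    then have "y = (z [^] (2::nat)) [^] n"
      by (simp add: nat_pow_pow)
    then show "y \<in> (\<lambda>x. x [^] n) ` carrier G"
      using z(1) by blast
  qed
  then have notin: "f x \<otimes> inv x \<notin> N"
    using n(2) by blast
  have "N #> f x \<noteq> N #> x"
  proof
    assume "N #> f x = N #> x"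
    then have "f x \<in> N #> x"
      using rcos_self[OF fx] subgroup_pow_image by (metis N_def)
    then obtain h where "h \<in> N" "f x = h \<otimes> x"
      by (auto simp: r_coset_def)
    moreover have "h \<in> carrier G"
      using \<open>h \<in> N\<close> by (auto simp: N_def)
    ultimately show False
      using notin x(1) by (simp add: m_assoc)
  qed
  then have "f ` (N #> x) \<noteq> N #> x"
    using core_auto_image_rcoset[OF f(1) x(1)] by (simp add: N_def)
  moreover have "N #> x \<in> rcosets N"
    using x(1) by (auto simp: RCOSETS_def)
  \<comment> \<open>The induced permutation moves the coset of \<open>x\<close>, so it is not the
    identity.\<close>
  ultimately have "(\<lambda>C\<in>rcosets N. f ` C) (N #> x) \<noteq> \<one>\<^bsub>BijGroup (rcosets N)\<^esub> (N #> x)"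
    by (simp add: BijGroup_def)
  then have "(\<lambda>C\<in>rcosets N. f ` C) \<noteq> \<one>\<^bsub>BijGroup (rcosets N)\<^esub>"
    by metis
  moreover have "finite (carrier (BijGroup (rcosets N)))"
    unfolding N_def using n(1) by (intro finite_carrier_BijGroup finite_rcosets_powers[OF S]) simp
  moreover have "(\<lambda>f. \<lambda>C\<in>rcosets N. f ` C) \<in> hom (QuandleAutoGroup (Core G)) (BijGroup (rcosets N))"
    unfolding N_def by (rule coset_action_hom)
  ultimately show "\<exists>(F :: ('a set \<Rightarrow> 'a set) monoid) \<phi>. group F \<and> finite (carrier F) \<and>
      \<phi> \<in> hom (QuandleAutoGroup (Core G)) F \<and> \<phi> f \<noteq> \<one>\<^bsub>F\<^esub>"
    by (intro exI[of _ "BijGroup (rcosets N)"] exI[of _ "\<lambda>f. \<lambda>C\<in>rcosets N. f ` C"] conjI group_BijGroup)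
qed

theorem proposition4p4:
  fixes G :: "('a, 'b) monoid_scheme"
  assumes "comm_group G"
    and "finitely_generated_group G"
    and "no_2_torsion G"
  shows "residually_finite (QuandleAutoGroup (Core G))"
  using assms(1,2) by (rule comm_group.residually_finite_QuandleAutoGroup_Core)

end
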